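(* Consider an element $m$ and, for each conserved variable, the semi-discretization $$(\boldsymbol{M}_m+\boldsymbol{K}_m)\frac{d}{dt}\hat{\boldsymbol{u}}_m(t)^T + \left[\boldsymbol{\chi}(\boldsymbol{\xi}_v^r)^T\ \ \boldsymbol{\chi}(\boldsymbol{\xi}_f^r)^T\right]\left[\left(\tilde{\boldsymbol{Q}} - \tilde{\boldsymbol{Q}}^T\right)\odot \boldsymbol{F}_m^r\right]\boldsymbol{1}^T+\sum_{f=1}^{N_f}\sum_{k=1}^{N_{fp}} \boldsymbol{\chi}(\boldsymbol{\xi}_{f,k}^r)^T W_{f,k}\,\hat{\boldsymbol{n}}^r\cdot \boldsymbol{f}_m^{*,r}=\boldsymbol{0}^T,$$ in which the flux reconstruction matrix $\boldsymbol{K}_m$ is built with an adaptively chosen (element-dependent and time-dependent) parameter $c=\varepsilon\, c_+\in[0,c_+]$, where $\varepsilon\in[0,1]$ is the output of a discontinuity sensor (the adaptive flux reconstruction, AFR, discretization). Then the discretization is locally conservative: for every element $m$, every choice of $c\in[0,c_+]$ made by the sensor on that element, and every time $t$ at which the semi-discretization holds, $$\hat{\boldsymbol{1}}\,\boldsymbol{M}_m\frac{d}{dt}\hat{\boldsymbol{u}}_m(t)^T = -\sum_{f=1}^{N_f}\sum_{k=1}^{N_{fp}}W_{f,k}\,\hat{\boldsymbol{n}}^r\cdot \boldsymbol{f}_m^{*,r},$$ where $\hat{\boldsymbol{1}}$ is the row vector of expansion coefficients of the constant function $1$ in the chosen basis.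
   Context: Setting: a high-order nonlinearly stable flux reconstruction (NSFR) semi-discretization of a system of hyperbolic conservation laws in $d\in\{1,2,3\}$ space dimensions, on elements mapped from a reference element $\Omega_r$ with coordinates $\boldsymbol{\xi}^r$. Polynomial degree is $p\ge 1$. Notation (vectors are rows, with transposes being columns): - $\boldsymbol{\chi}(\boldsymbol{\xi}^r)=(\chi_1(\boldsymbol{\xi}^r),\dots,\chi_{N_p}(\boldsymbol{\xi}^r))$ is a row of polynomial basis functions on $\Omega_r$ (tensor-product degree $p$), whose span contains the constants. $\boldsymbol{\chi}(\boldsymbol{\xi}_v^r)$ and $\boldsymbol{\chi}(\boldsymbol{\xi}_f^r)$ are the matrices whose rows are $\boldsymbol{\chi}$ evaluated at the volume quadrature points and at all facet quadrature points, respectively. $\boldsymbol{\xi}^r_{f,k}$ is the $k$-th quadrature point on face $f$, with $N_f$ faces and $N_{fp}$ points per face, and $W_{f,k}$ is its quadrature weight. - $\hat{\boldsymbol{u}}_m(t)\in\mathbb{R}^{1\times N_p}$ is the row of basis coefficients of the discrete solution (one conserved variable) on element $m$. - $\hat{\boldsymbol{1}}\in\mathbb{R}^{1\times N_p}$ is the row of coefficients of the constant function $1$: $\boldsymbol{\chi}(\boldsymbol{\xi}^r)\hat{\boldsymbol{1}}^T=1$ for all $\boldsymbol{\xi}^r$; in particular $\boldsymbol{\chi}(\boldsymbol{\xi}_v^r)\hat{\boldsymbol{1}}^T=\boldsymbol{1}^T$, where $\boldsymbol{1}$ denotes a row of ones of the appropriate length. - $\boldsymbol{M}_m$ is the mass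 matrix of element $m$, $(\boldsymbol{M}_m)_{ij}\approx\int_{\Omega_r}J_m^\Omega\,\chi_i\chi_j\,d\Omega_r$ (evaluated by quadrature), where $J_m^\Omega$ is the Jacobian determinant of the element mapping. - $\boldsymbol{K}_m$ is the flux reconstruction matrix $$(\boldsymbol{K}_m)_{ij}\approx\sum_{s,v,w}c_{(s,v,w)}\int_{\Omega_r}J_m^\Omega\,\partial^{(s,v,w)}\chi_i(\boldsymbol{\xi}^r)\,\partial^{(s,v,w)}\chi_j(\boldsymbol{\xi}^r)\,d\Omega_r,$$ evaluated by quadrature with exact derivatives of the basis functions, where $\partial^{(s,v,w)}=\partial_\xi^s\partial_\eta^v\partial_\zeta^w$ and the sum is over multi-indices of total order at least $p$ (the $p$-th order broken Sobolev space). The coefficients $c_{(s,v,w)}$ are determined by the scalar parameter $c$; $c=0$ gives $\boldsymbol{K}_m=0$ (discontinuous Galerkin), and $c_+$ denotes the largest stable value of $c$. - $\tilde{\boldsymbol{Q}}$ is the hybridized stiffness operator, a square matrix with rows and columns indexed by all volume and facet quadrature points, so $\tilde{\boldsymbol{Q}}-\tilde{\boldsymbol{Q}}^T$ is skew-symmetric. $\boldsymbol{F}_m^r$ is the matrix of reference two-point fluxes, whose $(i,j)$ entry is the two-point flux between quadrature points $i$ and $j$; it is symmetric in $(i,j)$. $\odot$ is the Hadamard (entrywise) product; in several dimensions there is one $\tilde{\boldsymbol{Q}}$ and one $\boldsymbol{F}_m^r$ per reference direction, and the Hadamard products are summed over directions. - $\hat{\boldsymbol{n}}^r$ is the reference facet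 normal and $\boldsymbol{f}_m^{*,r}$ is the numerical flux in reference space, both evaluated at $\boldsymbol{\xi}^r_{f,k}$ in the surface sum. *)

theory Defs
  imports "HOL-Analysis.Analysis"
begin

type_synonym 'd point = "(real, 'd) vec"

definition tensor_poly :: "nat \<Rightarrow> ('d::finite point \<Rightarrow> real) \<Rightarrow> bool" where
  "tensor_poly p f \<longleftrightarrow>
     (\<exists>a :: ('d \<Rightarrow> nat) \<Rightarrow> real.
        \<forall>x. f x = (\<Sum>\<alpha>\<in>{\<alpha>. \<forall>r. \<alpha> r \<le> p}. a \<alpha> * (\<Prod>r\<in>UNIV. (x $ r) ^ \<alpha> r)))"

definition partial_deriv :: "'d::finite \<Rightarrow> ('d point \<Rightarrow> real) \<Rightarrow> 'd point \<Rightarrow> real" where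
  "partial_deriv r f x = deriv (\<lambda>h. f (x + h *\<^sub>R axis r 1)) 0"

text \<open>The order on the coordinate directions only fixes the order in which the partial
  derivatives are applied; the first direction is differentiated last.\<close>

definition multi_deriv ::
    "('d::{finite,linorder} \<Rightarrow> nat) \<Rightarrow> ('d point \<Rightarrow> real) \<Rightarrow> 'd point \<Rightarrow> real" where
  "multi_deriv \<alpha> f =
     foldr (\<lambda>r. partial_deriv r ^^ \<alpha> r) (sorted_list_of_set UNIV) f"

definition jacobian_det :: "('d::finite point \<Rightarrow> 'd point) \<Rightarrow> 'd point \<Rightarrow> real" where
  "jacobian_det \<Theta> x = det (jacobian \<Theta> (at x))"

definition eval_matrix ::
    "('n::finite \<Rightarrow> 'd::finite point \<Rightarrow> real) \<Rightarrow> ('q \<Rightarrow> 'd point) \<Rightarrow> real^'n^'q" where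
  "eval_matrix chi xs = (\<chi> q i. chi i (xs q))"

definition mass_matrix ::
    "('n::finite \<Rightarrow> 'd::finite point \<Rightarrow> real) \<Rightarrow> ('q::finite \<Rightarrow> 'd point) \<Rightarrow> ('q \<Rightarrow> real) \<Rightarrow>
     ('d point \<Rightarrow> 'd point) \<Rightarrow> real^'n^'n" where
  "mass_matrix chi xv wv \<Theta> =
     (\<chi> i j. \<Sum>q\<in>UNIV. wv q * (jacobian_det \<Theta> (xv q) * chi i (xv q) * chi j (xv q)))"

text \<open>Multi-indices of total order at least \<open>p\<close>.  Only those bounded by \<open>p\<close> in every
  direction are listed, which makes the set finite: any other derivative annihilates a
  polynomial of tensor-product degree \<open>p\<close>.\<close>

definition fr_indices :: "nat \<Rightarrow> ('d::finite \<Rightarrow> nat) set" where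
  "fr_indices p = {\<alpha>. p \<le> (\<Sum>r\<in>UNIV. \<alpha> r) \<and> (\<forall>r. \<alpha> r \<le> p)}"

text \<open>The argument \<open>cf\<close> is the family of coefficients attached to the multi-indices.\<close>

definition fr_matrix ::
    "nat \<Rightarrow> (('d::{finite,linorder} \<Rightarrow> nat) \<Rightarrow> real) \<Rightarrow> ('n \<Rightarrow> 'd point \<Rightarrow> real) \<Rightarrow>
     ('q::finite \<Rightarrow> 'd point) \<Rightarrow> ('q \<Rightarrow> real) \<Rightarrow> ('d point \<Rightarrow> 'd point) \<Rightarrow> real^'n^'n" where
  "fr_matrix p cf chi xv wv \<Theta> =
     (\<chi> i j. \<Sum>\<alpha>\<in>fr_indices p. cf \<alpha> *
        (\<Sum>q\<in>UNIV. wv q * (jacobian_det \<Theta> (xv q) *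
           multi_deriv \<alpha> (chi i) (xv q) * multi_deriv \<alpha> (chi j) (xv q))))"

definition block_row :: "real^'q^'n \<Rightarrow> real^'g^'n \<Rightarrow> real^('q + 'g)^'n" where
  "block_row A B = (\<chi> i z. case z of Inl q \<Rightarrow> A $ i $ q | Inr g \<Rightarrow> B $ i $ g)"

definition hadamard :: "real^'b^'a \<Rightarrow> real^'b^'a \<Rightarrow> real^'b^'a" where
  "hadamard A B = (\<chi> i j. A $ i $ j * B $ i $ j)"

end

theory Submission
  imports Defs
begin

text \<open>Pair the scheme with the coefficients of the constant \<open>1\<close>.  A polynomial equal to \<open>1\<close> on
  a set with nonempty interior is \<open>1\<close> everywhere, so all its derivatives of order at least
  \<open>p \<ge> 1\<close> vanish at every node and the flux reconstruction matrix drops out for any choice of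
  its coefficients.  The volume term becomes the sum of all entries of a skew-symmetric matrix,
  and the facet term loses its basis functions.\<close>

text \<open>Passes to a class closed under composition with a line and equipped with an induction
  rule; the later arguments rest on both.\<close>

lemma tensor_poly_imp_real_polynomial_function:
  fixes f :: "'d::finite point \<Rightarrow> real"
  assumes "tensor_poly p f"
  shows "real_polynomial_function f"
proof -
  obtain a where a: "\<And>x. f x = (\<Sum>\<alpha>\<in>{\<alpha>. \<forall>r. \<alpha> r \<le> p}. a \<alpha> * (\<Prod>r\<in>UNIV. (x $ r) ^ \<alpha> r))"
    using assms unfolding tensor_poly_def by blast
  have fin: "finite {\<alpha> :: 'd \<Rightarrow> nat. \<forall>r. \<alpha> r \<le> p}"
    using finite_PiE[of UNIV "\<lambda>_::'d. {..p}"] by (simp add: PiE_def Pi_def)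
  have "real_polynomial_function
      (\<lambda>x::'d point. \<Sum>\<alpha>\<in>{\<alpha>. \<forall>r. \<alpha> r \<le> p}. a \<alpha> * (\<Prod>r\<in>UNIV. (x $ r) ^ \<alpha> r))"
    by (intro real_polynomial_function_sum real_polynomial_function.intros(4)
        real_polynomial_function_prod real_polynomial_function_power fin
        real_polynomial_function.intros(2) real_polynomial_function.intros(1)
        bounded_linear_vec_nth finite)
  moreover have "f = (\<lambda>x. \<Sum>\<alpha>\<in>{\<alpha>. \<forall>r. \<alpha> r \<le> p}. a \<alpha> * (\<Prod>r\<in>UNIV. (x $ r) ^ \<alpha> r))"
    using a by blast
  ultimately show ?thesis by simp
qed

text \<open>Restrict \<open>f\<close> to the line that is at an interior point \<open>x0\<close> for
  parameter 0 and at the arbitrary point \<open>x\<close> for parameter 1. This is a polynomial in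
  one variable with infinitely many roots, so all its coefficients vanish.\<close>

lemma real_polynomial_function_eq_0:
  fixes f :: "'a::real_normed_vector \<Rightarrow> real"
  assumes f: "real_polynomial_function f"
    and int: "interior S \<noteq> {}"
    and zero: "\<And>x. x \<in> S \<Longrightarrow> f x = 0"
  shows "f x = 0"
proof -
  obtain x0 where "x0 \<in> interior S" using int by blast
  define line where "line h = x0 + h *\<^sub>R (x - x0)" for h :: real
  have "polynomial_function line"
    unfolding line_def
    by (intro polynomial_function_add polynomial_function_const
        polynomial_function_bounded_linear bounded_linear_scaleR_left)
  then have "real_polynomial_function (f \<circ> line)"
    using f real_polynomial_function_compose by blast
  then obtain a n where a: "f \<circ> line = (\<lambda>h. \<Sum>i\<le>n. a i * h ^ i)"
    unfolding real_polynomial_function_iff_sum by blast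
  \<comment> \<open>The parameters that land in the interior of \<open>S\<close> form an open set of
    reals containing 0, and such a set is infinite.\<close>
  have "open (line -` interior S)"
    unfolding line_def by (intro open_vimage open_interior continuous_intros)
  moreover have "0 \<in> line -` interior S"
    using \<open>x0 \<in> interior S\<close> by (simp add: line_def)
  ultimately have "infinite (line -` interior S)"
    using finite_imp_not_open by blast
  moreover have "line -` interior S \<subseteq> {h. (\<Sum>i\<le>n. a i * h ^ i) = 0}"
    using zero interior_subset fun_cong[OF a] by (fastforce simp: o_def)
  ultimately have "infinite {h. (\<Sum>i\<le>n. a i * h ^ i) = 0}"
    using finite_subset by blast
  then have "\<forall>i\<le>n. a i = 0"
    using polyfun_finite_roots[of a n] by blast
  then have "(f \<circ> line) 1 = 0" unfolding a by simp
  then show ?thesis by (simp add: line_def)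
qed

text \<open>\<open>deriv\<close> is informative only where a derivative exists, which the second
  claim secures; the first lets partial derivatives be iterated.\<close>

lemma partial_deriv_real_polynomial_function:
  fixes f :: "'d::finite point \<Rightarrow> real"
  assumes "real_polynomial_function f"
  shows "real_polynomial_function (partial_deriv r f)"
    and "((\<lambda>h. f (x + h *\<^sub>R axis r 1)) has_real_derivative partial_deriv r f x) (at 0)"
proof -
  \<comment> \<open>The induction builds an explicit candidate \<open>g\<close> by the sum and
    product rules; uniqueness of derivatives then identifies it with
    \<open>partial_deriv r f\<close>.\<close>
  have "\<exists>g. real_polynomial_function g \<and>
      (\<forall>x. ((\<lambda>h. f (x + h *\<^sub>R axis r 1)) has_real_derivative g x) (at 0))"
    using assms
  proof induction
    case (linear f)
    have "((\<lambda>h. f (x + h *\<^sub>R axis r 1)) has_real_derivative f (axis r 1)) (at 0)" for x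
      unfolding linear_add[OF bounded_linear.linear[OF linear]]
        linear_cmul[OF bounded_linear.linear[OF linear]]
      by (auto intro!: derivative_eq_intros)
    then show ?case using real_polynomial_function.intros(2) by blast
  next
    case (const c)
    have "((\<lambda>h::real. c) has_real_derivative 0) (at 0)" by simp
    then show ?case using real_polynomial_function.intros(2) by blast
  next
    case (add f g)
    then obtain f' g' where "real_polynomial_function f'" "real_polynomial_function g'"
      and "\<And>x. ((\<lambda>h. f (x + h *\<^sub>R axis r 1)) has_real_derivative f' x) (at 0)"
      and "\<And>x. ((\<lambda>h. g (x + h *\<^sub>R axis r 1)) has_real_derivative g' x) (at 0)" by blast
    then show ?case
      by (intro exI[of _ "\<lambda>x. f' x + g' x"])
        (auto intro: real_polynomial_function.intros(3) DERIV_add)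
  next
    case (mult f g)
    then obtain f' g' where "real_polynomial_function f'" "real_polynomial_function g'"
      and "\<And>x. ((\<lambda>h. f (x + h *\<^sub>R axis r 1)) has_real_derivative f' x) (at 0)"
      and "\<And>x. ((\<lambda>h. g (x + h *\<^sub>R axis r 1)) has_real_derivative g' x) (at 0)" by blast
    with mult.hyps show ?case
      by (intro exI[of _ "\<lambda>x. f x * g' x + f' x * g x"])
        (auto intro!: real_polynomial_function.intros(3) real_polynomial_function.intros(4)
          derivative_eq_intros)
  qed
  then obtain g where g: "real_polynomial_function g"
    and d: "\<And>x. ((\<lambda>h. f (x + h *\<^sub>R axis r 1)) has_real_derivative g x) (at 0)" by blast
  have "partial_deriv r f = g"
    using d by (auto simp: fun_eq_iff partial_deriv_def intro: DERIV_imp_deriv)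
  with g d show "real_polynomial_function (partial_deriv r f)"
    and "((\<lambda>h. f (x + h *\<^sub>R axis r 1)) has_real_derivative partial_deriv r f x) (at 0)"
    by auto
qed

lemma partial_deriv_sum:
  fixes f :: "'i \<Rightarrow> 'd::finite point \<Rightarrow> real"
  assumes "\<And>i. real_polynomial_function (f i)"
  shows "partial_deriv r (\<lambda>x. \<Sum>i\<in>I. f i x * c i) = (\<lambda>x. \<Sum>i\<in>I. partial_deriv r (f i) x * c i)"
proof
  fix x
  have "((\<lambda>h. \<Sum>i\<in>I. f i (x + h *\<^sub>R axis r 1) * c i)
      has_real_derivative (\<Sum>i\<in>I. partial_deriv r (f i) x * c i)) (at 0)"
    by (intro DERIV_sum DERIV_cmult_right partial_deriv_real_polynomial_function assms)
  then show "partial_deriv r (\<lambda>x. \<Sum>i\<in>I. f i x * c i) x = (\<Sum>i\<in>I. partial_deriv r (f i) x * c i)"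
    unfolding partial_deriv_def[of r "\<lambda>x. \<Sum>i\<in>I. f i x * c i"] by (rule DERIV_imp_deriv)
qed

text \<open>Polynomiality travels along in the induction because each further use of
  \<open>partial_deriv_sum\<close> requires it.\<close>

lemma funpow_partial_deriv_sum:
  fixes f :: "'i \<Rightarrow> 'd::finite point \<Rightarrow> real"
  assumes "\<And>i. real_polynomial_function (f i)"
  shows "(\<forall>i. real_polynomial_function ((partial_deriv r ^^ n) (f i))) \<and>
    (partial_deriv r ^^ n) (\<lambda>x. \<Sum>i\<in>I. f i x * c i)
      = (\<lambda>x. \<Sum>i\<in>I. (partial_deriv r ^^ n) (f i) x * c i)"
  by (induction n)
    (auto simp: assms partial_deriv_sum intro: partial_deriv_real_polynomial_function)

lemma multi_deriv_sum:
  fixes f :: "'i \<Rightarrow> 'd::{finite,linorder} point \<Rightarrow> real"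
  assumes "\<And>i. real_polynomial_function (f i)"
  shows "multi_deriv \<alpha> (\<lambda>x. \<Sum>i\<in>I. f i x * c i) = (\<lambda>x. \<Sum>i\<in>I. multi_deriv \<alpha> (f i) x * c i)"
proof -
  \<comment> \<open>Replacing the sorted list of all directions by an arbitrary list makes induction
    on the list possible.\<close>
  define D :: "'d list \<Rightarrow> ('d point \<Rightarrow> real) \<Rightarrow> 'd point \<Rightarrow> real"
    where "D rs = foldr (\<lambda>r. partial_deriv r ^^ \<alpha> r) rs" for rs
  have "(\<forall>i. real_polynomial_function (D rs (f i))) \<and>
      D rs (\<lambda>x. \<Sum>i\<in>I. f i x * c i) = (\<lambda>x. \<Sum>i\<in>I. D rs (f i) x * c i)" for rs
  proof (induction rs)
    case Nil
    then show ?case by (simp add: D_def assms)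
  next
    case (Cons r rs)
    then show ?case
      using funpow_partial_deriv_sum[of "\<lambda>i. D rs (f i)"] by (simp add: D_def)
  qed
  then show ?thesis by (simp add: multi_deriv_def D_def)
qed

text \<open>One differentiated direction suffices: it turns the constant into 0, and the remaining
  derivatives keep it 0.\<close>

lemma multi_deriv_const:
  fixes \<alpha> :: "'d::{finite,linorder} \<Rightarrow> nat"
  assumes "\<alpha> r \<noteq> 0"
  shows "multi_deriv \<alpha> (\<lambda>_. c) = (\<lambda>_. 0)"
proof -
  have const: "partial_deriv r (\<lambda>_. c) = (\<lambda>_. 0)" for r :: 'd and c
    by (rule ext) (simp add: partial_deriv_def)
  have "(partial_deriv r ^^ n) (\<lambda>_. c) = (\<lambda>_. if n = 0 then c else 0)" for r :: 'd and n c
    by (induction n) (simp_all add: const)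
  then have "foldr (\<lambda>r. partial_deriv r ^^ \<alpha> r) rs (\<lambda>_. c)
      = (\<lambda>_. if \<forall>r\<in>set rs. \<alpha> r = 0 then c else 0)" for rs
    by (induction rs) auto
  then show ?thesis using assms by (auto simp: multi_deriv_def)
qed

text \<open>The sum of all entries is unchanged by transposition, yet skew-symmetry flips its sign,
  so it equals its own negative.\<close>

lemma sum_entries_skew:
  fixes A :: "real^'a^'a"
  assumes "\<And>i j. A $ j $ i = - A $ i $ j"
  shows "1 \<bullet> (A *v 1) = 0"
proof -
  have "1 \<bullet> (A *v 1) = (1 v* A) \<bullet> 1"
    by (simp add: dot_lmul_matrix)
  also have "1 v* A = - (A *v 1)"
  proof -
    have "(\<Sum>i\<in>UNIV. A $ i $ j) = - (\<Sum>i\<in>UNIV. A $ j $ i)" for j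
      unfolding sum_negf[symmetric] by (rule sum.cong[OF refl assms])
    then show ?thesis
      by (simp add: vec_eq_iff vector_matrix_mult_def matrix_vector_mult_def)
  qed
  finally show ?thesis by (simp add: inner_commute)
qed

theorem theorem1:
  fixes p :: nat
    and \<Omega> :: "('d::{finite,linorder}) point set"
    and chi :: "'n::finite \<Rightarrow> 'd point \<Rightarrow> real"
    and one_hat :: "real^'n"
    and xv :: "'q::finite \<Rightarrow> 'd point" and wv :: "'q \<Rightarrow> real"
    and xf :: "'f::finite \<times> 'k::finite \<Rightarrow> 'd point" and W :: "'f \<Rightarrow> 'k \<Rightarrow> real"
    and nr :: "'f \<Rightarrow> 'k \<Rightarrow> 'd point"
    and \<Theta> :: "'m \<Rightarrow> 'd point \<Rightarrow> 'd point"
    and coef :: "real \<Rightarrow> ('d \<Rightarrow> nat) \<Rightarrow> real"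
    and c_plus :: real
    and \<epsilon> :: "'m \<Rightarrow> real \<Rightarrow> real"
    and Q :: "'d \<Rightarrow> real^('q + 'f \<times> 'k)^('q + 'f \<times> 'k)"
    and F :: "'m \<Rightarrow> 's \<Rightarrow> real \<Rightarrow> 'd \<Rightarrow> real^('q + 'f \<times> 'k)^('q + 'f \<times> 'k)"
    and fstar :: "'m \<Rightarrow> 's \<Rightarrow> real \<Rightarrow> 'f \<Rightarrow> 'k \<Rightarrow> 'd point"
    and u :: "'m \<Rightarrow> 's \<Rightarrow> real \<Rightarrow> real^'n"
    and m :: 'm and s :: 's and t :: real
  assumes dim: "CARD('d) \<in> {1, 2, 3}"
    and degree: "p \<ge> 1"
    and reference_element: "compact \<Omega>" "interior \<Omega> \<noteq> {}"
    and volume_nodes: "\<And>q. xv q \<in> \<Omega>"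
    and facet_nodes: "\<And>f k. xf (f, k) \<in> frontier \<Omega>"
    and basis_poly: "\<And>i. tensor_poly p (chi i)"
    and basis_indep: "\<And>a :: real^'n. (\<forall>x\<in>\<Omega>. (\<Sum>i\<in>UNIV. chi i x * a $ i) = 0) \<Longrightarrow> a = 0"
    and one_hat: "\<And>x. x \<in> \<Omega> \<Longrightarrow> (\<Sum>i\<in>UNIV. chi i x * one_hat $ i) = 1"
    and mapping: "\<And>m q. \<Theta> m differentiable (at (xv q))"
    and coef_zero: "\<And>\<alpha>. coef 0 \<alpha> = 0"
    and c_plus: "0 \<le> c_plus"
    and sensor: "\<And>m t. \<epsilon> m t \<in> {0..1}"
    and flux_symmetric: "\<And>m s t r. transpose (F m s t r) = F m s t r"
    and u_differentiable: "u m s differentiable (at t)"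
    and semi_discretization:
      "(mass_matrix chi xv wv (\<Theta> m)
          + fr_matrix p (coef (\<epsilon> m t * c_plus)) chi xv wv (\<Theta> m))
           *v vector_derivative (u m s) (at t)
       + block_row (transpose (eval_matrix chi xv)) (transpose (eval_matrix chi xf))
           *v ((\<Sum>r\<in>UNIV. hadamard (Q r - transpose (Q r)) (F m s t r)) *v 1)
       + (\<Sum>f\<in>UNIV. \<Sum>k\<in>UNIV.
            (W f k * (nr f k \<bullet> fstar m s t f k)) *\<^sub>R (\<chi> i. chi i (xf (f, k))))
       = 0"
  shows "one_hat \<bullet> (mass_matrix chi xv wv (\<Theta> m) *v vector_derivative (u m s) (at t))
       = - (\<Sum>f\<in>UNIV. \<Sum>k\<in>UNIV. W f k * (nr f k \<bullet> fstar m s t f k))"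
proof -
  have poly: "real_polynomial_function (chi i)" for i
    using basis_poly tensor_poly_imp_real_polynomial_function by blast
  \<comment> \<open>The expansion is known to be 1 on \<Omega> only, while derivatives at a node on
    the boundary also see values outside \<Omega>; hence the extension to all points.\<close>
  have "real_polynomial_function (\<lambda>x. (\<Sum>i\<in>UNIV. chi i x * one_hat $ i) - 1)"
    by (intro real_polynomial_function_diff real_polynomial_function_sum
        real_polynomial_function.intros(4) real_polynomial_function.intros(2) poly finite)
  then have "(\<Sum>i\<in>UNIV. chi i x * one_hat $ i) - 1 = 0" for x
    by (rule real_polynomial_function_eq_0[OF _ reference_element(2)]) (simp add: one_hat)
  then have one: "(\<Sum>i\<in>UNIV. chi i x * one_hat $ i) = 1" for x
    by simp

  have deriv: "(\<Sum>i\<in>UNIV. multi_deriv \<alpha> (chi i) x * one_hat $ i) = 0"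
    if "\<alpha> \<in> fr_indices p" for \<alpha> x
  proof -
    \<comment> \<open>Here p \<ge> 1 enters: it excludes the zero multi-index, whose derivative
      would leave the constant 1 intact.\<close>
    have "(\<Sum>r\<in>UNIV. \<alpha> r) \<noteq> 0"
      using that degree unfolding fr_indices_def by (simp del: sum_eq_0_iff)
    then obtain r where "\<alpha> r \<noteq> 0" by (meson sum.neutral)
    then have "multi_deriv \<alpha> (\<lambda>x. \<Sum>i\<in>UNIV. chi i x * one_hat $ i) x = 0"
      unfolding one by (simp add: multi_deriv_const)
    then show ?thesis by (simp add: multi_deriv_sum poly)
  qed
  define K where "K = fr_matrix p (coef (\<epsilon> m t * c_plus)) chi xv wv (\<Theta> m)"
  have "(one_hat v* K) $ j = 0" for j
  proof -
    \<comment> \<open>\<open>?w\<close> collects every factor independent of \<open>i\<close>. Once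
      the sum over \<open>i\<close> is innermost, \<open>deriv\<close> makes it vanish for each
      \<alpha> and each node, whatever the value of the sensor.\<close>
    let ?w = "\<lambda>\<alpha> q. coef (\<epsilon> m t * c_plus) \<alpha> *
      (wv q * (jacobian_det (\<Theta> m) (xv q) * multi_deriv \<alpha> (chi j) (xv q)))"
    have "(one_hat v* K) $ j = (\<Sum>i\<in>UNIV. \<Sum>\<alpha>\<in>fr_indices p. \<Sum>q\<in>UNIV.
        ?w \<alpha> q * (multi_deriv \<alpha> (chi i) (xv q) * one_hat $ i))"
      by (simp add: K_def fr_matrix_def vector_matrix_mult_def sum_distrib_left
          sum_distrib_right algebra_simps)
    also have "\<dots> = (\<Sum>\<alpha>\<in>fr_indices p. \<Sum>i\<in>UNIV. \<Sum>q\<in>UNIV.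
        ?w \<alpha> q * (multi_deriv \<alpha> (chi i) (xv q) * one_hat $ i))"
      by (rule sum.swap)
    also have "\<dots> = (\<Sum>\<alpha>\<in>fr_indices p. \<Sum>q\<in>UNIV. \<Sum>i\<in>UNIV.
        ?w \<alpha> q * (multi_deriv \<alpha> (chi i) (xv q) * one_hat $ i))"
      by (intro sum.cong refl sum.swap)
    also have "\<dots> = (\<Sum>\<alpha>\<in>fr_indices p. \<Sum>q\<in>UNIV.
        ?w \<alpha> q * (\<Sum>i\<in>UNIV. multi_deriv \<alpha> (chi i) (xv q) * one_hat $ i))"
      unfolding sum_distrib_left ..
    also have "\<dots> = 0"
      by (simp add: deriv)
    finally show ?thesis .
  qed
  then have "one_hat v* K = 0" by (simp add: vec_eq_iff)
  then have fr: "one_hat \<bullet> (K *v v) = 0" for v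
    by (metis dot_lmul_matrix inner_zero_left)

  define B where "B = block_row (transpose (eval_matrix chi xv)) (transpose (eval_matrix chi xf))"
  define A where "A = (\<Sum>r\<in>UNIV. hadamard (Q r - transpose (Q r)) (F m s t r))"
  \<comment> \<open>Each entry is the constant 1 evaluated at a volume or facet node, so the row is
    all ones and the volume term reduces to the sum of the entries of \<open>A\<close>.\<close>
  have "(one_hat v* B) $ z = 1" for z
    using one by (cases z)
      (simp_all add: B_def block_row_def eval_matrix_def transpose_def vector_matrix_mult_def
        mult.commute)
  then have "one_hat v* B = 1" by (simp add: vec_eq_iff)
  moreover have "A $ j $ i = - A $ i $ j" for i j
  proof -
    have "F m s t r $ i $ j = F m s t r $ j $ i" for r i j
      using arg_cong[OF flux_symmetric, of "\<lambda>B. B $ i $ j" m s t r]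
      by (simp add: transpose_def)
    \<comment> \<open>In each direction, a skew-symmetric factor times a symmetric flux is
      skew-symmetric entrywise; summing over directions preserves this.\<close>
    then have neg: "(Q r $ j $ i - Q r $ i $ j) * F m s t r $ j $ i
        = - ((Q r $ i $ j - Q r $ j $ i) * F m s t r $ i $ j)" for r i j
      by (metis minus_diff_eq minus_mult_left)
    have "A $ i $ j = (\<Sum>r\<in>UNIV. (Q r $ i $ j - Q r $ j $ i) * F m s t r $ i $ j)" for i j
      by (simp add: A_def transpose_def hadamard_def)
    then show ?thesis
      by (simp only: sum_negf[symmetric]) (intro sum.cong refl neg)
  qed
  ultimately have volume: "one_hat \<bullet> (B *v (A *v 1)) = 0"
    by (metis dot_lmul_matrix sum_entries_skew)

  have facet: "one_hat \<bullet> (\<chi> i. chi i (xf (f, k))) = 1" for f k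
    using one by (simp add: inner_vec_def mult.commute)

  let ?v = "vector_derivative (u m s) (at t)"
  \<comment> \<open>Of the paired scheme, \<open>fr\<close> and \<open>volume\<close> remove the
    middle terms, and \<open>facet\<close> reduces each surface contribution to its weighted normal
    flux.\<close>
  have "one_hat \<bullet> ((mass_matrix chi xv wv (\<Theta> m) + K) *v ?v + B *v (A *v 1)
      + (\<Sum>f\<in>UNIV. \<Sum>k\<in>UNIV.
           (W f k * (nr f k \<bullet> fstar m s t f k)) *\<^sub>R (\<chi> i. chi i (xf (f, k))))) = 0"
    using semi_discretization unfolding K_def A_def B_def by simp
  then show ?thesis
    by (simp add: inner_add_right inner_sum_right facet fr volume
        matrix_vector_mult_add_rdistrib)
qed

end
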